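(* Let $E \subset \mathbb{H}$ be symmetric and $3$-regular. Then $E$ is contained in a vertical plane.
   Context: The first Heisenberg group is $\mathbb{H} = (\mathbb{R}^{3},\cdot)$ with group law $(x,y,t)\cdot(x',y',t') = (x+x',y+y',t+t'+\tfrac12(xy'-yx'))$. Put $\|(x,y,t)\| = ((x^2+y^2)^2+16t^2)^{1/4}$ and $d(p,q) = \|q^{-1}\cdot p\|$, a metric on $\mathbb{H}$. $B(p,r)$ denotes the open $d$-ball, and Hausdorff measures $\mathcal{H}^s$ and diameters are taken with respect to $d$. An $\mathcal{H}^{3}$-measurable set $E \subset \mathbb{H}$ is $3$-regular if there is a constant $A \geq 1$ such that $r^{3}/A \leq \mathcal{H}^{3}(E \cap B(p,r)) \leq A r^{3}$ for all $p \in E$ and $0 < r \leq \operatorname{diam}(E)$. Let $\pi(x,y,t) = (x,y)$. For $p,q \in \mathbb{H}$ the symmetric point of $q$ relative to $p$ is $\Sigma_p(q) = q\cdot(2\pi(p)-2\pi(q),0)$. A set $E \subset \mathbb{H}$ is symmetric if $\Sigma_p(q) \in E$ for all $p,q \in E$. A vertical plane is a (left) translate of a $2$-dimensional linear plane in $\mathbb{R}^3$ containing the $t$-axis. *)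

theory Defs
  imports "HOL-Analysis.Analysis"
begin

section \<open>Hausdorff measures with respect to an explicit metric\<close>

text \<open>The library \<^const>\<open>diameter\<close> is real-valued, belongs to the type class metric and is
  \<open>0\<close> on unbounded sets; here the metric is a parameter and unbounded sets have diameter \<open>\<infinity>\<close>.\<close>

definition ediam :: "('a \<Rightarrow> 'a \<Rightarrow> real) \<Rightarrow> 'a set \<Rightarrow> ennreal" where
  "ediam d A = (SUP x\<in>A. SUP y\<in>A. ennreal (d x y))"

text \<open>The case distinction makes the empty set contribute \<open>0\<close> also for \<open>s = 0\<close>. No normalising
  constant is included.\<close>

definition hausdorff_content ::
    "('a \<Rightarrow> 'a \<Rightarrow> real) \<Rightarrow> nat \<Rightarrow> real \<Rightarrow> 'a set \<Rightarrow> ennreal" where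
  "hausdorff_content d s \<delta> A =
     (INF U \<in> {U :: nat \<Rightarrow> 'a set. A \<subseteq> (\<Union>i. U i) \<and> (\<forall>i. ediam d (U i) \<le> ennreal \<delta>)}.
        \<Sum>i. if U i = {} then 0 else ediam d (U i) ^ s)"

definition hausdorff_measure :: "('a \<Rightarrow> 'a \<Rightarrow> real) \<Rightarrow> nat \<Rightarrow> 'a set \<Rightarrow> ennreal" where
  "hausdorff_measure d s A = (SUP \<delta>\<in>{0<..}. hausdorff_content d s \<delta> A)"

text \<open>Caratheodory measurability for the outer measure \<^term>\<open>hausdorff_measure d s\<close>.\<close>

definition hausdorff_measurable :: "('a \<Rightarrow> 'a \<Rightarrow> real) \<Rightarrow> nat \<Rightarrow> 'a set \<Rightarrow> bool" where
  "hausdorff_measurable d s E \<longleftrightarrow> E \<in> lambda_system UNIV UNIV (hausdorff_measure d s)"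


section \<open>The first Heisenberg group\<close>

type_synonym heis = "real \<times> real \<times> real"

fun heis_mult :: "heis \<Rightarrow> heis \<Rightarrow> heis" (infixl \<open>\<cdot>\<^sub>H\<close> 70) where
  "(x, y, t) \<cdot>\<^sub>H (x', y', t') = (x + x', y + y', t + t' + (1/2) * (x * y' - y * x'))"

fun heis_inv :: "heis \<Rightarrow> heis" where
  "heis_inv (x, y, t) = (- x, - y, - t)"

lemma heis_mult_assoc: "p \<cdot>\<^sub>H q \<cdot>\<^sub>H r = p \<cdot>\<^sub>H (q \<cdot>\<^sub>H r)"
  by (cases p; cases q; cases r) (simp add: field_simps)

lemma heis_mult_zero [simp]: "p \<cdot>\<^sub>H 0 = p" "0 \<cdot>\<^sub>H p = p"
  by (cases p; simp add: zero_prod_def)+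

lemma heis_mult_inv [simp]: "p \<cdot>\<^sub>H heis_inv p = 0" "heis_inv p \<cdot>\<^sub>H p = 0"
  by (cases p; simp add: zero_prod_def)+

fun heis_norm :: "heis \<Rightarrow> real" where
  "heis_norm (x, y, t) = root 4 ((x\<^sup>2 + y\<^sup>2)\<^sup>2 + 16 * t\<^sup>2)"

definition heis_dist :: "heis \<Rightarrow> heis \<Rightarrow> real" where
  "heis_dist p q = heis_norm (heis_inv q \<cdot>\<^sub>H p)"

lemma heis_norm_cmod: "heis_norm (x, y, t) = sqrt (cmod (Complex (x\<^sup>2 + y\<^sup>2) (4 * t)))"
proof -
  have "root 4 a = sqrt (sqrt a)" for a
    using real_root_mult_exp[of 2 2 a] by (simp add: sqrt_def)
  then show ?thesis
    by (simp add: cmod_def power_mult_distrib)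
qed

lemma heis_norm_nonneg: "0 \<le> heis_norm p"
  by (cases p) (simp add: heis_norm_cmod del: heis_norm.simps)

lemma heis_norm_eq_0: "heis_norm p = 0 \<longleftrightarrow> p = 0"
  by (cases p) (auto simp: heis_norm_cmod complex_eq_iff sum_power2_eq_zero_iff zero_prod_def
      simp del: heis_norm.simps)

lemma heis_norm_inv: "heis_norm (heis_inv p) = heis_norm p"
  by (cases p) simp

lemma heis_norm_mult_le: "heis_norm (p \<cdot>\<^sub>H q) \<le> heis_norm p + heis_norm q"
proof -
  obtain x y t x' y' t' where p: "p = (x, y, t)" and q: "q = (x', y', t')"
    by (cases p; cases q)
  define A where "A = Complex (x\<^sup>2 + y\<^sup>2) (4 * t)"
  define B where "B = Complex (x'\<^sup>2 + y'\<^sup>2) (4 * t')"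
  define Z where "Z = Complex x (- y) * Complex x' y'"
  have le: "sqrt (a\<^sup>2 + b\<^sup>2) \<le> sqrt (cmod (Complex (a\<^sup>2 + b\<^sup>2) c))" for a b c
    using abs_Re_le_cmod[of "Complex (a\<^sup>2 + b\<^sup>2) c"] by simp
  have "cmod Z = sqrt (x\<^sup>2 + y\<^sup>2) * sqrt (x'\<^sup>2 + y'\<^sup>2)"
    unfolding Z_def norm_mult by (simp add: cmod_def)
  also have "\<dots> \<le> sqrt (cmod A) * sqrt (cmod B)"
    unfolding A_def B_def by (intro mult_mono le) auto
  finally have Z: "cmod Z \<le> sqrt (cmod A) * sqrt (cmod B)" .
  have "Complex ((x + x')\<^sup>2 + (y + y')\<^sup>2) (4 * (t + t' + (1/2) * (x * y' - y * x'))) = A + B + 2 * Z"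
    by (simp add: A_def B_def Z_def complex_eq_iff power2_eq_square algebra_simps)
  then have "(heis_norm (p \<cdot>\<^sub>H q))\<^sup>2 = cmod (A + B + 2 * Z)"
    by (simp add: p q heis_norm_cmod del: heis_norm.simps)
  also have "\<dots> \<le> cmod A + cmod B + 2 * cmod Z"
    using norm_triangle_ineq[of "A + B" "2 * Z"] norm_triangle_ineq[of A B] by (simp add: norm_mult)
  also have "\<dots> \<le> cmod A + cmod B + 2 * (sqrt (cmod A) * sqrt (cmod B))"
    using Z by simp
  also have "\<dots> = (heis_norm p + heis_norm q)\<^sup>2"
    by (simp add: p q heis_norm_cmod A_def B_def power2_sum del: heis_norm.simps)
  finally show ?thesis
    by (rule power2_le_imp_le) (simp add: heis_norm_nonneg)
qed

lemma heis_mult_inv_cancel: "heis_inv r \<cdot>\<^sub>H p = (heis_inv r \<cdot>\<^sub>H q) \<cdot>\<^sub>H (heis_inv q \<cdot>\<^sub>H p)"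
  by (metis heis_mult_assoc heis_mult_inv(1) heis_mult_zero(2))

text \<open>Balls are those of this metric, not those of the Euclidean class instance on \<^typ>\<open>heis\<close>.\<close>

interpretation heis: Metric_space UNIV heis_dist
proof
  fix p q r :: heis
  show "0 \<le> heis_dist p q"
    by (simp add: heis_dist_def heis_norm_nonneg)
  have "heis_inv (heis_inv q \<cdot>\<^sub>H p) = heis_inv p \<cdot>\<^sub>H q"
    by (cases p; cases q) (simp add: field_simps)
  then show "heis_dist p q = heis_dist q p"
    by (metis heis_dist_def heis_norm_inv)
  have "heis_inv q \<cdot>\<^sub>H p = 0 \<longleftrightarrow> p = q"
    by (metis heis_mult_assoc heis_mult_inv heis_mult_zero)
  then show "heis_dist p q = 0 \<longleftrightarrow> p = q"
    by (simp add: heis_dist_def heis_norm_eq_0)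
  show "heis_dist p r \<le> heis_dist p q + heis_dist q r"
    using heis_norm_mult_le[of "heis_inv r \<cdot>\<^sub>H q" "heis_inv q \<cdot>\<^sub>H p"]
    by (simp add: heis_dist_def heis_mult_inv_cancel[of r p q])
qed


section \<open>Regular sets, symmetric sets, vertical planes\<close>

text \<open>The comparison \<open>ennreal r \<le> ediam heis_dist E\<close> admits every \<open>r > 0\<close> when \<open>E\<close> is unbounded.\<close>

definition three_regular :: "heis set \<Rightarrow> bool" where
  "three_regular E \<longleftrightarrow>
     hausdorff_measurable heis_dist 3 E \<and>
     (\<exists>A::real. A \<ge> 1 \<and>
        (\<forall>p\<in>E. \<forall>r>0. ennreal r \<le> ediam heis_dist E \<longrightarrow>
           ennreal (r ^ 3 / A) \<le> hausdorff_measure heis_dist 3 (E \<inter> heis.mball p r) \<and>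
           hausdorff_measure heis_dist 3 (E \<inter> heis.mball p r) \<le> ennreal (A * r ^ 3)))"

fun heis_proj :: "heis \<Rightarrow> real \<times> real" where
  "heis_proj (x, y, t) = (x, y)"

definition symmetric_point :: "heis \<Rightarrow> heis \<Rightarrow> heis" where
  "symmetric_point p q =
     (let (a, b) = 2 *\<^sub>R heis_proj p - 2 *\<^sub>R heis_proj q in q \<cdot>\<^sub>H (a, b, 0))"

definition heis_symmetric :: "heis set \<Rightarrow> bool" where
  "heis_symmetric E \<longleftrightarrow> (\<forall>p\<in>E. \<forall>q\<in>E. symmetric_point p q \<in> E)"

definition vertical_plane :: "heis set \<Rightarrow> bool" where
  "vertical_plane V \<longleftrightarrow>
     (\<exists>p W. subspace W \<and> dim W = 2 \<and> {(0, 0, t) | t. True} \<subseteq> W \<and> V = (\<lambda>w. p \<cdot>\<^sub>H w) ` W)"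

end

theory Submission
  imports Defs
begin

text \<open>The composition of the symmetries at two points \<open>a\<close>, \<open>b\<close> of \<open>E\<close> is a left translation,
  hence an isometry, which preserves \<open>E\<close>. If three points of \<open>E\<close> have non-collinear
  projections, two such translations generate, through their commutator, a non-trivial vertical
  translation. The orbit of a point then contains about \<open>N\<^sup>4\<close> uniformly separated points at distance
  \<open>O(N)\<close>, because vertical distances scale like the square root, and regularity gives
  \<open>N\<^sup>4 \<le> C N\<^sup>3\<close> for all \<open>N\<close>, which is absurd.\<close>

section \<open>Hausdorff outer measure of separated sets, and packing\<close>

lemma ediam_mono: "A \<subseteq> B \<Longrightarrow> ediam d A \<le> ediam d B"
  unfolding ediam_def by (meson SUP_subset_mono order_refl)

lemma dist_le_ediam:
  assumes "x \<in> A" "y \<in> A"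
  shows "ennreal (d x y) \<le> ediam d A"
  unfolding ediam_def using assms by (meson SUP_upper SUP_upper2)

lemma hausdorff_content_mono_set:
  "A \<subseteq> B \<Longrightarrow> hausdorff_content d s \<delta> A \<le> hausdorff_content d s \<delta> B"
  unfolding hausdorff_content_def by (rule INF_superset_mono) auto

lemma hausdorff_content_antimono:
  "\<delta> \<le> \<delta>' \<Longrightarrow> hausdorff_content d s \<delta>' A \<le> hausdorff_content d s \<delta> A"
  unfolding hausdorff_content_def
  by (rule INF_superset_mono) (auto intro: order_trans ennreal_leI)

lemma hausdorff_measure_mono:
  "A \<subseteq> B \<Longrightarrow> hausdorff_measure d s A \<le> hausdorff_measure d s B"
  unfolding hausdorff_measure_def by (intro SUP_mono' hausdorff_content_mono_set)

text \<open>A covering set of diameter at most \<open>\<delta>\<close> cannot meet both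
  \<open>A\<close> and \<open>B\<close>, which are at least \<open>\<epsilon>\<close> apart. Cutting
  a cover of the union down to \<open>A\<close> and to \<open>B\<close> therefore covers both sets
  at no extra total cost.\<close>

lemma hausdorff_content_separated_Un:
  assumes sep: "\<And>x y. x \<in> A \<Longrightarrow> y \<in> B \<Longrightarrow> \<epsilon> \<le> d x y" and "0 < \<epsilon>" "\<delta> < \<epsilon>"
  shows "hausdorff_content d s \<delta> A + hausdorff_content d s \<delta> B \<le> hausdorff_content d s \<delta> (A \<union> B)"
proof -
  define f where "f V = (if V = {} then 0 else ediam d V ^ s)" for V
  have content: "hausdorff_content d s \<delta> C \<le> (\<Sum>i. f (U i \<inter> C))"
    if "C \<subseteq> (\<Union>i. U i)" "\<And>i. ediam d (U i) \<le> ennreal \<delta>" for U :: "nat \<Rightarrow> _" and C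
  proof -
    have "ediam d (U i \<inter> C) \<le> ennreal \<delta>" for i
      using ediam_mono[of "U i \<inter> C" "U i" d] that(2)[of i] by (meson Int_lower1 order_trans)
    then show ?thesis
      unfolding hausdorff_content_def f_def using that(1) by (intro INF_lower) auto
  qed
  have "hausdorff_content d s \<delta> A + hausdorff_content d s \<delta> B \<le> (\<Sum>i. f (U i))"
    if U: "A \<union> B \<subseteq> (\<Union>i. U i)" "\<And>i. ediam d (U i) \<le> ennreal \<delta>" for U :: "nat \<Rightarrow> _"
  proof -
    have split: "f (U i \<inter> A) + f (U i \<inter> B) \<le> f (U i)" for i
    proof -
      have mono: "f (U i \<inter> C) \<le> f (U i)" for C
        unfolding f_def by (auto intro: power_mono ediam_mono)
      have "U i \<inter> A = {} \<or> U i \<inter> B = {}"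
      proof (rule ccontr)
        assume "\<not> ?thesis"
        then obtain x y where xy: "x \<in> U i" "x \<in> A" "y \<in> U i" "y \<in> B"
          by blast
        have "ennreal \<epsilon> \<le> ennreal (d x y)"
          using sep xy by (intro ennreal_leI) auto
        also have "\<dots> \<le> ennreal \<delta>"
          using dist_le_ediam[of x "U i" y d] xy U(2) by (meson order_trans)
        finally show False
          using \<open>0 < \<epsilon>\<close> \<open>\<delta> < \<epsilon>\<close> by (metis ennreal_lessI not_le)
      qed
      \<comment> \<open>The empty one of the two pieces costs nothing, even for
        \<open>s = 0\<close>, because of the case distinction in \<open>f\<close>.\<close>
      moreover have "f {} = 0"
        by (simp add: f_def)
      ultimately show ?thesis
        using mono[of A] mono[of B] by auto
    qed
    have "hausdorff_content d s \<delta> A + hausdorff_content d s \<delta> B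
        \<le> (\<Sum>i. f (U i \<inter> A)) + (\<Sum>i. f (U i \<inter> B))"
      using U by (intro add_mono content) auto
    also have "\<dots> = (\<Sum>i. f (U i \<inter> A) + f (U i \<inter> B))"
      by (simp add: suminf_add)
    also have "\<dots> \<le> (\<Sum>i. f (U i))"
      by (intro suminf_le split) auto
    finally show ?thesis .
  qed
  then show ?thesis
    unfolding hausdorff_content_def[of d s \<delta> "A \<union> B"] f_def by (intro INF_greatest) auto
qed

text \<open>The nontrivial half of additivity for a metric outer measure. Covers split only at
  scales below \<open>\<epsilon>\<close>, but contents grow as the scale shrinks, so restricting to
  such scales loses nothing.\<close>

lemma hausdorff_measure_separated_Un:
  assumes sep: "\<And>x y. x \<in> A \<Longrightarrow> y \<in> B \<Longrightarrow> \<epsilon> \<le> d x y" and "0 < \<epsilon>"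
  shows "hausdorff_measure d s A + hausdorff_measure d s B \<le> hausdorff_measure d s (A \<union> B)"
proof -
  \<comment> \<open>The smaller of two scales dominates both contents, so the sum of the two suprema
    is a single supremum over a common scale.\<close>
  have directed: "hausdorff_content d s \<delta> A + hausdorff_content d s \<delta>' B
      \<le> hausdorff_content d s (min \<delta> \<delta>') A + hausdorff_content d s (min \<delta> \<delta>') B" for \<delta> \<delta>'
    by (intro add_mono hausdorff_content_antimono) auto
  have "hausdorff_measure d s A + hausdorff_measure d s B
      = (SUP \<delta>\<in>{0<..}. hausdorff_content d s \<delta> A + hausdorff_content d s \<delta> B)"
    unfolding hausdorff_measure_def
    by (intro SUP_add_directed_ennreal[symmetric])
      (use directed in \<open>meson greaterThan_iff min_less_iff_conj\<close>)
  also have "\<dots> \<le> hausdorff_measure d s (A \<union> B)"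
  proof (rule SUP_least)
    fix \<delta> :: real
    assume "\<delta> \<in> {0<..}"
    define \<delta>' where "\<delta>' = min \<delta> (\<epsilon> / 2)"
    have \<delta>': "0 < \<delta>'" "\<delta>' < \<epsilon>" "\<delta>' \<le> \<delta>"
      using \<open>\<delta> \<in> {0<..}\<close> \<open>0 < \<epsilon>\<close> by (auto simp: \<delta>'_def)
    have "hausdorff_content d s \<delta> A + hausdorff_content d s \<delta> B
        \<le> hausdorff_content d s \<delta>' A + hausdorff_content d s \<delta>' B"
      using \<delta>' by (intro add_mono hausdorff_content_antimono)
    also have "\<dots> \<le> hausdorff_content d s \<delta>' (A \<union> B)"
      using assms \<delta>' by (intro hausdorff_content_separated_Un)
    also have "\<dots> \<le> hausdorff_measure d s (A \<union> B)"
      unfolding hausdorff_measure_def using \<delta>' by (intro SUP_upper) auto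
    finally show "hausdorff_content d s \<delta> A + hausdorff_content d s \<delta> B
        \<le> hausdorff_measure d s (A \<union> B)" .
  qed
  finally show ?thesis .
qed

lemma hausdorff_measure_separated_UN:
  assumes "finite I" "0 < \<epsilon>"
    and "\<And>i j x y. i \<in> I \<Longrightarrow> j \<in> I \<Longrightarrow> i \<noteq> j \<Longrightarrow> x \<in> A i \<Longrightarrow> y \<in> A j \<Longrightarrow> \<epsilon> \<le> d x y"
  shows "(\<Sum>i\<in>I. hausdorff_measure d s (A i)) \<le> hausdorff_measure d s (\<Union>i\<in>I. A i)"
  using assms(1,3)
proof (induction I rule: finite_induct)
  case (insert i I)
  have "(\<Sum>j\<in>insert i I. hausdorff_measure d s (A j))
      \<le> hausdorff_measure d s (A i) + hausdorff_measure d s (\<Union>j\<in>I. A j)"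
    using insert by (auto intro!: add_left_mono insert.IH)
  also have "\<dots> \<le> hausdorff_measure d s (A i \<union> (\<Union>j\<in>I. A j))"
    using insert.hyps insert.prems \<open>0 < \<epsilon>\<close>
    by (intro hausdorff_measure_separated_Un[of _ _ \<epsilon>]) auto
  finally show ?case
    by simp
qed simp

text \<open>Packing bound: balls of radius \<open>r\<close> about \<open>3 * r\<close>-separated
  centres stay at least \<open>r\<close> apart, so their masses add up inside the large
  ball.\<close>

lemma regular_separated_card_le:
  fixes c :: real
  assumes lower: "\<And>q. q \<in> E \<Longrightarrow>
      ennreal c \<le> hausdorff_measure heis_dist s (E \<inter> heis.mball q r)"
    and "finite I" "f ` I \<subseteq> E" "0 < r" "0 \<le> c"
    and sep: "\<And>i j. i \<in> I \<Longrightarrow> j \<in> I \<Longrightarrow> i \<noteq> j \<Longrightarrow> 3 * r \<le> heis_dist (f i) (f j)"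
    and near: "\<And>i. i \<in> I \<Longrightarrow> heis_dist p (f i) + r \<le> R"
  shows "ennreal (card I * c) \<le> hausdorff_measure heis_dist s (E \<inter> heis.mball p R)"
proof -
  have "ennreal (card I * c) = (\<Sum>i\<in>I. ennreal c)"
    using \<open>0 \<le> c\<close> by (simp add: ennreal_mult ennreal_of_nat_eq_real_of_nat)
  also have "\<dots> \<le> (\<Sum>i\<in>I. hausdorff_measure heis_dist s (E \<inter> heis.mball (f i) r))"
    using \<open>f ` I \<subseteq> E\<close> by (intro sum_mono lower) auto
  also have "\<dots> \<le> hausdorff_measure heis_dist s (\<Union>i\<in>I. E \<inter> heis.mball (f i) r)"
  proof (rule hausdorff_measure_separated_UN[OF \<open>finite I\<close> \<open>0 < r\<close>])
    fix i j x y
    assume ij: "i \<in> I" "j \<in> I" "i \<noteq> j"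
      and x: "x \<in> E \<inter> heis.mball (f i) r" and y: "y \<in> E \<inter> heis.mball (f j) r"
    have "heis_dist (f i) (f j) \<le> heis_dist (f i) x + heis_dist x y + heis_dist (f j) y"
      using heis.triangle[of "f i" x "f j"] heis.triangle[of x y "f j"] heis.commute[of y "f j"]
      by simp
    then show "r \<le> heis_dist x y"
      using sep[OF ij] x y by simp
  qed
  also have "\<dots> \<le> hausdorff_measure heis_dist s (E \<inter> heis.mball p R)"
  proof (intro hausdorff_measure_mono subsetI)
    fix x
    assume "x \<in> (\<Union>i\<in>I. E \<inter> heis.mball (f i) r)"
    then obtain i where "i \<in> I" "x \<in> E" "x \<in> heis.mball (f i) r"
      by blast
    then show "x \<in> E \<inter> heis.mball p R"
      using near[of i] heis.triangle[of p "f i" x] by simp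
  qed
  finally show ?thesis .
qed

section \<open>The area form and the Heisenberg norm\<close>

text \<open>The standard symplectic form of the projections, equal to twice the correction term in
  the group law.\<close>

definition area_form :: "heis \<Rightarrow> heis \<Rightarrow> real" where
  "area_form p q = fst p * fst (snd q) - fst (snd p) * fst q"

lemma heis_dist_left: "heis_dist (g \<cdot>\<^sub>H p) (g \<cdot>\<^sub>H q) = heis_dist p q"
proof -
  have "heis_inv (g \<cdot>\<^sub>H q) = heis_inv q \<cdot>\<^sub>H heis_inv g"
    by (cases g; cases q) (simp add: field_simps)
  then show ?thesis
    unfolding heis_dist_def by (metis heis_mult_assoc heis_mult_inv(2) heis_mult_zero(1))
qed

text \<open>The fourth power of the norm contains \<open>(x\<^sup>2 + y\<^sup>2)\<^sup>2\<close>, so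
  the norm dominates each horizontal coordinate. This turns lower bounds on areas into lower bounds
  on distances.\<close>

lemma area_form_le: "\<bar>area_form p q\<bar> \<le> (\<bar>fst q\<bar> + \<bar>fst (snd q)\<bar>) * heis_norm p"
proof -
  obtain x y t where p: "p = (x, y, t)"
    by (cases p)
  have "root 4 (a ^ 4) \<le> heis_norm p" if "a\<^sup>2 \<le> x\<^sup>2 + y\<^sup>2" for a
  proof -
    have "a ^ 4 = (a\<^sup>2)\<^sup>2"
      by simp
    also have "\<dots> \<le> (x\<^sup>2 + y\<^sup>2)\<^sup>2"
      using that by (intro power_mono) auto
    also have "\<dots> \<le> (x\<^sup>2 + y\<^sup>2)\<^sup>2 + 16 * t\<^sup>2"
      by simp
    finally show ?thesis
      by (simp add: p)
  qed
  moreover have "root 4 (a ^ 4) = \<bar>a\<bar>" for a :: real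
    using real_root_power_cancel[of 4 "\<bar>a\<bar>"] by simp
  ultimately have "\<bar>x\<bar> \<le> heis_norm p" "\<bar>y\<bar> \<le> heis_norm p"
    by (metis le_add_same_cancel1 zero_le_power2, metis le_add_same_cancel2 zero_le_power2)
  then have "\<bar>x\<bar> * \<bar>fst (snd q)\<bar> + \<bar>y\<bar> * \<bar>fst q\<bar>
      \<le> heis_norm p * \<bar>fst (snd q)\<bar> + heis_norm p * \<bar>fst q\<bar>"
    by (intro add_mono mult_right_mono) auto
  then show ?thesis
    unfolding area_form_def p
    by (simp add: abs_mult[symmetric] algebra_simps)
qed

text \<open>The area form vanishes on the pair \<open>g\<close>, \<open>g\<close>, so natural
  multiples of \<open>g\<close> are its group powers and the triangle inequality applies.\<close>

lemma heis_norm_scaleR_nat: "heis_norm (real n *\<^sub>R g) \<le> n * heis_norm g"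
proof (induction n)
  case 0
  have "heis_norm 0 = 0"
    by (simp add: heis_norm_eq_0)
  then show ?case
    by simp
next
  case (Suc n)
  have "real (Suc n) *\<^sub>R g = g \<cdot>\<^sub>H (real n *\<^sub>R g)"
    by (cases g) (simp add: field_simps)
  then show ?case
    using heis_norm_mult_le[of g "real n *\<^sub>R g"] Suc by (simp add: algebra_simps)
qed

text \<open>This square-root growth lets about \<open>N\<^sup>2\<close> vertical steps fit into a
  ball of radius of order \<open>N\<close>.\<close>

lemma heis_norm_vertical: "heis_norm (0, 0, t) = 2 * sqrt \<bar>t\<bar>"
proof -
  have "heis_norm (0, 0, t) = root 4 ((2 * sqrt \<bar>t\<bar>) ^ 4)"
    by (simp add: power_mult_distrib power4_eq_xxxx power2_eq_square)
  also have "\<dots> = 2 * sqrt \<bar>t\<bar>"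
    by (rule real_root_power_cancel) auto
  finally show ?thesis .
qed

lemma scaleR_nat_orbit:
  assumes "\<And>q. q \<in> E \<Longrightarrow> g \<cdot>\<^sub>H q \<in> E" "q \<in> E"
  shows "(real n *\<^sub>R g) \<cdot>\<^sub>H q \<in> E"
proof (induction n)
  case (Suc n)
  have "real (Suc n) *\<^sub>R g = g \<cdot>\<^sub>H (real n *\<^sub>R g)"
    by (cases g) (simp add: field_simps)
  then show ?case
    using assms(1)[OF Suc] by (simp add: heis_mult_assoc)
qed (use assms(2) in simp)

section \<open>Translations from pairs of symmetries, and collinearity by orbit counting\<close>

definition double_symmetry :: "heis \<Rightarrow> heis \<Rightarrow> heis" where
  "double_symmetry a b = (2 * (fst b - fst a), 2 * (fst (snd b) - fst (snd a)), 2 * area_form a b)"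

text \<open>The two symmetries change the last coordinate by \<open>area_form q a\<close> and then
  by the area form of \<open>2a - q\<close> and \<open>b\<close>. The sum is affine in
  \<open>q\<close>, with linear part the correction term of a left translation.\<close>

lemma symmetric_point_symmetric_point:
  "symmetric_point b (symmetric_point a q) = double_symmetry a b \<cdot>\<^sub>H q"
  by (cases a; cases b; cases q)
    (simp add: symmetric_point_def double_symmetry_def area_form_def field_simps)

text \<open>Swapping the arguments of \<open>double_symmetry\<close> gives the inverse element, so
  the left side is a group commutator. Its height is the area form of the two horizontal parts, each
  of which carries a factor 2.\<close>

lemma double_symmetry_commutator:
  "double_symmetry a b \<cdot>\<^sub>H (double_symmetry a c \<cdot>\<^sub>H (double_symmetry b a \<cdot>\<^sub>H double_symmetry c a))
    = (0, 0, 4 * area_form (b - a) (c - a))"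
  by (cases a; cases b; cases c) (simp add: double_symmetry_def area_form_def field_simps)

text \<open>The conclusion says that the projections of \<open>a\<close>, \<open>b\<close>, \<open>c\<close> are collinear.\<close>

lemma regular_symmetric_collinear:
  assumes sym: "heis_symmetric E" and reg: "three_regular E"
    and abc: "a \<in> E" "b \<in> E" "c \<in> E"
  shows "area_form (b - a) (c - a) = 0"
proof (rule ccontr)
  define D where "D = area_form (b - a) (c - a)"
  assume "area_form (b - a) (c - a) \<noteq> 0"
  then have D: "\<bar>D\<bar> > 0"
    by (simp add: D_def)
  have inv: "double_symmetry p p' \<cdot>\<^sub>H q \<in> E" if "p \<in> E" "p' \<in> E" "q \<in> E" for p p' q
    using sym that by (metis heis_symmetric_def symmetric_point_symmetric_point)
  define g where "g = double_symmetry a b"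
  define h where "h = double_symmetry a c"
  define z where "z = (0::real, 0::real, 4 * D)"
  \<comment> \<open>The commutator identity writes \<open>z\<close> as a product of four double
    symmetries, each of which maps \<open>E\<close> into itself.\<close>
  have z_inv: "z \<cdot>\<^sub>H q \<in> E" if "q \<in> E" for q
    unfolding z_def D_def double_symmetry_commutator[symmetric] heis_mult_assoc
    using abc that by (intro inv)
  \<comment> \<open>The orbit points of \<open>a\<close> under the words \<open>g^m h^n z^k\<close>,
    with powers written as scalar multiples.\<close>
  define P where "P = (\<lambda>(m::nat, n::nat, k::nat).
    (real m *\<^sub>R g) \<cdot>\<^sub>H ((real n *\<^sub>R h) \<cdot>\<^sub>H ((real k *\<^sub>R z) \<cdot>\<^sub>H a)))"
  have P_in: "P i \<in> E" for i
    unfolding P_def using abc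
    by (auto split: prod.split intro!: scaleR_nat_orbit inv z_inv simp: g_def h_def)
  \<comment> \<open>\<open>S\<close> dominates the coefficients in \<open>area_form_le\<close> for
    both \<open>g\<close> and \<open>h\<close>; the summand 1 makes division by it safe.\<close>
  define S where "S = 1 + \<bar>fst g\<bar> + \<bar>fst (snd g)\<bar> + \<bar>fst h\<bar> + \<bar>fst (snd h)\<bar>"
  have S: "S \<ge> 1"
    by (simp add: S_def)
  have g_h: "area_form g h = 4 * D"
    by (simp add: g_def h_def D_def double_symmetry_def area_form_def algebra_simps)
  \<comment> \<open>Horizontally the displacement is \<open>m - m'\<close> times \<open>g\<close>
    plus \<open>n - n'\<close> times \<open>h\<close>. Pairing with \<open>h\<close> isolates the
    first exponent, pairing with \<open>g\<close> the second.\<close>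
  have area_form_P: "area_form (heis_inv (P (m', n', k')) \<cdot>\<^sub>H P (m, n, k)) h = (real m - real m') * (4 * D)"
    "area_form (heis_inv (P (m', n', k')) \<cdot>\<^sub>H P (m, n, k)) g = (real n' - real n) * (4 * D)"
    for m n k m' n' k'
    unfolding g_h[symmetric]
    by (cases a; cases g; cases h; simp add: P_def z_def area_form_def algebra_simps)+
  have dist_m: "\<bar>real m - real m'\<bar> * (4 * \<bar>D\<bar> / S) \<le> heis_dist (P (m, n, k)) (P (m', n', k'))"
    and dist_n: "\<bar>real n - real n'\<bar> * (4 * \<bar>D\<bar> / S) \<le> heis_dist (P (m, n, k)) (P (m', n', k'))"
    for m n k m' n' k'
  proof -
    define w where "w = heis_inv (P (m', n', k')) \<cdot>\<^sub>H P (m, n, k)"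
    have "\<bar>area_form w h\<bar> \<le> S * heis_norm w" "\<bar>area_form w g\<bar> \<le> S * heis_norm w"
      by (rule order_trans[OF area_form_le], intro mult_right_mono heis_norm_nonneg, simp add: S_def)+
    then show "\<bar>real m - real m'\<bar> * (4 * \<bar>D\<bar> / S) \<le> heis_dist (P (m, n, k)) (P (m', n', k'))"
      "\<bar>real n - real n'\<bar> * (4 * \<bar>D\<bar> / S) \<le> heis_dist (P (m, n, k)) (P (m', n', k'))"
      using S unfolding w_def area_form_P heis_dist_def abs_mult abs_minus_commute[of "real n'"]
      by (simp_all add: divide_le_eq mult.commute)
  qed
  \<comment> \<open>Left invariance removes the common prefix. As \<open>z\<close> is central, what
    remains is a vertical displacement of height at least \<open>4 * \<bar>D\<bar>\<close>.\<close>
  have dist_k: "2 * sqrt (4 * \<bar>D\<bar>) \<le> heis_dist (P (m, n, k)) (P (m, n, k'))"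
    if "k \<noteq> k'" for m n k k'
  proof -
    have "heis_inv ((real k' *\<^sub>R z) \<cdot>\<^sub>H a) \<cdot>\<^sub>H ((real k *\<^sub>R z) \<cdot>\<^sub>H a)
        = (0, 0, (real k - real k') * (4 * D))"
      by (cases a) (simp add: z_def algebra_simps)
    then have "heis_dist (P (m, n, k)) (P (m, n, k'))
        = 2 * sqrt (\<bar>real k - real k'\<bar> * (4 * \<bar>D\<bar>))"
      unfolding P_def split heis_dist_left unfolding heis_dist_def
      by (simp add: heis_norm_vertical abs_mult del: heis_norm.simps)
    moreover have "1 * (4 * \<bar>D\<bar>) \<le> \<bar>real k - real k'\<bar> * (4 * \<bar>D\<bar>)"
      using that by (intro mult_right_mono) auto
    ultimately show ?thesis
      by simp
  qed
  \<comment> \<open>The first entry separates points that differ in \<open>m\<close> or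
    \<open>n\<close>, the second those that differ only in \<open>k\<close>; the division by 3 fits
    the packing bound.\<close>
  define r where "r = min (4 * \<bar>D\<bar> / S) (2 * sqrt (4 * \<bar>D\<bar>)) / 3"
  have r: "0 < r"
    using D S by (simp add: r_def)
  have sep: "3 * r \<le> heis_dist (P i) (P j)" if ne: "i \<noteq> j" for i j
  proof -
    obtain m n k m' n' k' where ij: "i = (m, n, k)" "j = (m', n', k')"
      by (cases i; cases j)
    have step: "4 * \<bar>D\<bar> / S \<le> \<bar>real l - real l'\<bar> * (4 * \<bar>D\<bar> / S)" if "l \<noteq> l'" for l l'
      using mult_right_mono[of 1 "\<bar>real l - real l'\<bar>" "4 * \<bar>D\<bar> / S"] that S by auto
    consider "m \<noteq> m'" | "n \<noteq> n'" | "m = m'" "n = n'" "k \<noteq> k'"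
      using ne ij by auto
    then show ?thesis
    proof cases
      case 1
      then show ?thesis
        using step[OF 1] dist_m[of m m' n k n' k'] by (simp add: r_def ij)
    next
      case 2
      then show ?thesis
        using step[OF 2] dist_n[of n n' m k m' k'] by (simp add: r_def ij)
    next
      case 3
      then show ?thesis
        using dist_k[of k k' m n] by (simp add: r_def ij)
    qed
  qed
  \<comment> \<open>Powers of \<open>g\<close> carry the orbit arbitrarily far, so \<open>E\<close>
    has infinite diameter and regularity is available at every radius.\<close>
  have ediam: "ennreal \<rho> \<le> ediam heis_dist E" for \<rho>
  proof -
    obtain m where m: "\<rho> < real m * (4 * \<bar>D\<bar> / S)"
      using ex_less_of_nat_mult[of "4 * \<bar>D\<bar> / S" \<rho>] D S by auto
    have "ennreal \<rho> \<le> ennreal (heis_dist (P (m, 0, 0)) (P (0, 0, 0)))"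
      using m dist_m[of m 0 0 0 0 0] by (intro ennreal_leI) simp
    also have "\<dots> \<le> ediam heis_dist E"
      by (intro dist_le_ediam P_in)
    finally show ?thesis .
  qed
  obtain A where A: "A \<ge> 1" and
    lower: "\<And>p \<rho>. p \<in> E \<Longrightarrow> 0 < \<rho> \<Longrightarrow>
      ennreal (\<rho> ^ 3 / A) \<le> hausdorff_measure heis_dist 3 (E \<inter> heis.mball p \<rho>)" and
    upper: "\<And>p \<rho>. p \<in> E \<Longrightarrow> 0 < \<rho> \<Longrightarrow>
      hausdorff_measure heis_dist 3 (E \<inter> heis.mball p \<rho>) \<le> ennreal (A * \<rho> ^ 3)"
    using reg ediam unfolding three_regular_def by blast
  \<comment> \<open>One summand for each factor of \<open>P i\<close>; \<open>a\<close> counts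
    twice, as last factor and as centre of the large ball, and \<open>r\<close> leaves room for the
    small balls.\<close>
  define C where "C = 2 * heis_norm a + heis_norm g + heis_norm h + heis_norm z + r"
  have C: "0 < C"
    using r heis_norm_nonneg[of a] heis_norm_nonneg[of g] heis_norm_nonneg[of h]
      heis_norm_nonneg[of z] by (simp add: C_def)
  have bound: "real N * (r ^ 3 / A) \<le> A * C ^ 3" if "N \<ge> 1" for N :: nat
  proof -
    \<comment> \<open>The longer range for \<open>k\<close> uses the square-root growth of vertical
      norms: the orbit points stay within \<open>C * N\<close> of \<open>a\<close>, yet there are
      \<open>N ^ 4\<close> of them.\<close>
    define I where "I = {..<N} \<times> {..<N} \<times> {..<N\<^sup>2}"
    have near: "heis_dist a (P i) + r \<le> C * N" if "i \<in> I" for i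
    proof -
      obtain m n k where i: "i = (m, n, k)" and mnk: "m < N" "n < N" "k < N\<^sup>2"
        using \<open>i \<in> I\<close> by (auto simp: I_def)
      have "heis_norm (real m *\<^sub>R g) \<le> N * heis_norm g"
        using heis_norm_scaleR_nat[of m g] mnk heis_norm_nonneg[of g]
        by (meson less_imp_le mult_right_mono of_nat_le_iff order_trans)
      moreover have "heis_norm (real n *\<^sub>R h) \<le> N * heis_norm h"
        using heis_norm_scaleR_nat[of n h] mnk heis_norm_nonneg[of h]
        by (meson less_imp_le mult_right_mono of_nat_le_iff order_trans)
      moreover have "heis_norm (real k *\<^sub>R z) \<le> N * heis_norm z"
      proof -
        have "sqrt (real k) \<le> N"
          using mnk by (intro real_le_lsqrt) (auto simp flip: of_nat_power)
        then show ?thesis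
          by (simp add: z_def heis_norm_vertical abs_mult real_sqrt_mult mult_right_mono
              del: heis_norm.simps)
      qed
      moreover have "heis_dist a (P i) \<le> heis_norm a + (heis_norm (real m *\<^sub>R g)
          + (heis_norm (real n *\<^sub>R h) + (heis_norm (real k *\<^sub>R z) + heis_norm a)))"
        unfolding heis.commute[of a "P i"] unfolding heis_dist_def P_def i split
        by (intro order_trans[OF heis_norm_mult_le] add_mono order_refl)
          (simp_all add: heis_norm_inv)
      moreover have "1 * (2 * heis_norm a + r) \<le> N * (2 * heis_norm a + r)"
        using \<open>N \<ge> 1\<close> r heis_norm_nonneg[of a] by (intro mult_right_mono) auto
      ultimately show ?thesis
        by (simp add: C_def algebra_simps)
    qed
    have "ennreal (card I * (r ^ 3 / A)) \<le> hausdorff_measure heis_dist 3 (E \<inter> heis.mball a (C * N))"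
    proof (rule regular_separated_card_le)
      show "P ` I \<subseteq> E" "finite I"
        using P_in by (auto simp: I_def)
      show "0 \<le> r ^ 3 / A"
        using r A by simp
    qed (rule lower sep near r | assumption)+
    also have "\<dots> \<le> ennreal (A * (C * N) ^ 3)"
      using abc C \<open>N \<ge> 1\<close> by (intro upper) auto
    finally have "card I * (r ^ 3 / A) \<le> A * (C * N) ^ 3"
      using A C by (simp add: ennreal_le_iff)
    moreover have "real (card I) = real N ^ 3 * N"
      by (simp add: I_def card_cartesian_product power3_eq_cube power2_eq_square)
    ultimately have "real N ^ 3 * (N * (r ^ 3 / A)) \<le> real N ^ 3 * (A * C ^ 3)"
      by (simp add: power_mult_distrib algebra_simps)
    then show ?thesis
      using \<open>N \<ge> 1\<close> by (subst (asm) mult_le_cancel_left_pos) auto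
  qed
  obtain N :: nat where "A * C ^ 3 < real N * (r ^ 3 / A)"
    using ex_less_of_nat_mult[of "r ^ 3 / A" "A * C ^ 3"] r A by auto
  \<comment> \<open>\<open>bound\<close> asks for a positive index, hence the successor.\<close>
  then have "A * C ^ 3 < real (Suc N) * (r ^ 3 / A)"
    using r A by (simp add: field_simps add_strict_increasing)
  then show False
    using bound[of "Suc N"] by simp
qed

section \<open>From collinear projections to a vertical plane\<close>

text \<open>The plane \<open>W\<close> orthogonal to \<open>(- y, x, 0)\<close> contains the
  vertical axis, so whether \<open>heis_inv p \<cdot>\<^sub>H q\<close> lies in it depends only on
  the difference of the projections.\<close>

lemma collinear_imp_vertical_plane:
  assumes "(x, y) \<noteq> (0, 0)" and "\<And>q. q \<in> E \<Longrightarrow> area_form (x, y, 0) (q - p) = 0"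
  shows "\<exists>V. vertical_plane V \<and> E \<subseteq> V"
proof -
  define W where "W = {w :: heis. (- y, x, 0) \<bullet> w = 0}"
  have "(- y, x, 0) \<noteq> (0 :: heis)"
    using assms(1) by (auto simp: zero_prod_def)
  then have "dim W = 2"
    unfolding W_def by (subst dim_hyperplane) auto
  moreover have "subspace W"
    unfolding W_def by (rule subspace_hyperplane)
  moreover have "{(0, 0, t) | t. True} \<subseteq> W"
    by (auto simp: W_def)
  ultimately have "vertical_plane ((\<lambda>w. p \<cdot>\<^sub>H w) ` W)"
    unfolding vertical_plane_def by blast
  moreover have "q \<in> (\<lambda>w. p \<cdot>\<^sub>H w) ` W" if "q \<in> E" for q
  proof
    show "q = p \<cdot>\<^sub>H (heis_inv p \<cdot>\<^sub>H q)"
      by (simp flip: heis_mult_assoc)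
    show "heis_inv p \<cdot>\<^sub>H q \<in> W"
      using assms(2)[OF that] by (cases p; cases q) (simp add: W_def area_form_def algebra_simps)
  qed
  ultimately show ?thesis
    by blast
qed

theorem theorem2p22:
  fixes E :: "heis set"
  assumes "heis_symmetric E"
    and "three_regular E"
  shows "\<exists>V. vertical_plane V \<and> E \<subseteq> V"
proof (cases "\<exists>a\<in>E. \<exists>b\<in>E. heis_proj a \<noteq> heis_proj b")
  case True
  then obtain a b where ab: "a \<in> E" "b \<in> E" "heis_proj a \<noteq> heis_proj b"
    by blast
  define x y where "x = fst (b - a)" and "y = fst (snd (b - a))"
  have "(x, y) \<noteq> (0, 0)"
    using ab(3) by (cases a; cases b) (auto simp: x_def y_def)
  moreover have "area_form (x, y, 0) (q - a) = 0" if "q \<in> E" for q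
    using regular_symmetric_collinear[OF assms ab(1,2) that] by (simp add: area_form_def x_def y_def)
  ultimately show ?thesis
    by (rule collinear_imp_vertical_plane)
next
  case False
  \<comment> \<open>If \<open>E\<close> is empty, \<open>p\<close> is arbitrary. Otherwise all
    projections agree with that of \<open>p\<close>, and any horizontal direction, here
    \<open>(1, 0)\<close>, gives a suitable plane.\<close>
  obtain p where p: "E \<subseteq> {} \<or> p \<in> E"
    by blast
  have "area_form (1, 0, 0) (q - p) = 0" if "q \<in> E" for q
    using False p that by (cases p; cases q) (fastforce simp: area_form_def)
  then show ?thesis
    by (intro collinear_imp_vertical_plane[of 1 0]) auto
qed

end
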